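(* Let $z_1,z_2,z_3\in\mathbb{C}$ with $|z_i|=1$ and $z_1z_2z_3=1$; put $T_p=z_1^p+z_2^p+z_3^p$ for $p\in\mathbb{Z}$, $Z=\frac13T_1$, $\bar Z=\frac13T_{-1}$, and $$P(X)=1-3\bar ZX+3ZX^2-X^3,\qquad \bar P(X)=1-3ZX+3\bar ZX^2-X^3 .$$ For $p,q\ge0$ let $S_{p,q}=T_pT_{-q}-T_{p-q}$. Then for $|X|<1$, $|Y|<1$, $$\sum_{p,q\ge0}S_{p,q}X^pY^q=\Big(3-X\frac{\bar P'(X)}{\bar P(X)}\Big)\Big(3-Y\frac{P'(Y)}{P(Y)}\Big)+\frac{1}{1-XY}\Big(X\frac{\bar P'(X)}{\bar P(X)}+Y\frac{P'(Y)}{P(Y)}-3\Big).$$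
   Context: Here $P'$ and $\bar P'$ denote derivatives with respect to the polynomial's variable ($X$ or $Y$), with $Z,\bar Z$ fixed; $\bar Z$ is the complex conjugate of $Z$. *)

theory Defs
  imports "HOL-Analysis.Analysis" "HOL-Computational_Algebra.Polynomial"
begin

definition power_sum :: "complex \<Rightarrow> complex \<Rightarrow> complex \<Rightarrow> int \<Rightarrow> complex" where
  "power_sum z1 z2 z3 p = z1 powi p + z2 powi p + z3 powi p"

definition S_coeff :: "complex \<Rightarrow> complex \<Rightarrow> complex \<Rightarrow> nat \<Rightarrow> nat \<Rightarrow> complex" where
  "S_coeff z1 z2 z3 p q =
     power_sum z1 z2 z3 (int p) * power_sum z1 z2 z3 (- int q) - power_sum z1 z2 z3 (int p - int q)"

text \<open>
  In the next two definitions \<open>Zb\<close> stands for the conjugate of \<open>Z\<close>. It is a separate argument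
  because it is introduced as a third of the power sum with exponent \<open>-1\<close>; the lemma below
  shows that on the unit circle the two descriptions agree.
\<close>

definition P_poly :: "complex \<Rightarrow> complex \<Rightarrow> complex poly" where
  "P_poly Z Zb = [:1, - 3 * Zb, 3 * Z, - 1:]"

definition Pbar_poly :: "complex \<Rightarrow> complex \<Rightarrow> complex poly" where
  "Pbar_poly Z Zb = [:1, - 3 * Z, 3 * Zb, - 1:]"

lemma power_sum_minus_one_eq_cnj:
  assumes "norm z1 = 1" "norm z2 = 1" "norm z3 = 1"
  shows "power_sum z1 z2 z3 (- 1) / 3 = cnj (power_sum z1 z2 z3 1 / 3)"
proof -
  have "inverse z = cnj z" if "norm z = 1" for z :: complex
    using that complex_norm_square[of z] by (intro inverse_unique) simp
  then show ?thesis
    using assms by (simp add: power_sum_def power_int_minus)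
qed

end

theory Submission
  imports Defs
begin

text \<open>
  Since \<open>z\<^sub>1 z\<^sub>2 z\<^sub>3 = 1\<close>, \<open>Pbar_poly\<close> and \<open>P_poly\<close> factor as the products of the
  \<open>1 - z\<^sub>i X\<close> and of the \<open>1 - Y / z\<^sub>i\<close>, so \<open>3\<close> minus the logarithmic derivative term is the
  sum \<open>A\<^sub>1 + A\<^sub>2 + A\<^sub>3\<close> (respectively \<open>B\<^sub>1 + B\<^sub>2 + B\<^sub>3\<close>) of the geometric series
  \<open>A\<^sub>i = 1 / (1 - z\<^sub>i X)\<close>, \<open>B\<^sub>i = 1 / (1 - Y / z\<^sub>i)\<close>. The double series is
  \<open>(\<Sum>A\<^sub>i) (\<Sum>B\<^sub>i) - \<Sum>A\<^sub>i B\<^sub>i\<close>, and the diagonal terms satisfy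
  \<open>(1 - X Y) A\<^sub>i B\<^sub>i = A\<^sub>i + B\<^sub>i - 1\<close>.
\<close>

lemma has_sum_geometric:
  fixes a :: "'a :: {real_normed_field, banach}"
  assumes "norm a < 1"
  shows "((\<lambda>n. a ^ n) has_sum (1 / (1 - a))) UNIV"
  using assms
  by (intro norm_summable_imp_has_sum geometric_sums) (simp_all add: norm_power)

lemma has_sum_geometric_product:
  fixes a b :: complex
  assumes a: "norm a < 1" and b: "norm b < 1"
  shows "((\<lambda>(p, q). a ^ p * b ^ q) has_sum (1 / (1 - a) * (1 / (1 - b)))) UNIV"
proof -
  \<comment> \<open>Summing over \<open>q\<close> and then over \<open>p\<close> yields the sum over
    pairs only once the family is known to be summable; the norms, being nonnegative, supply
    this.\<close>
  have "(\<lambda>(p, q). norm a ^ p * norm b ^ q) summable_on UNIV \<times> UNIV"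
  proof (rule summable_on_SigmaI)
    show "((\<lambda>q. case (p, q) of (p, q) \<Rightarrow> norm a ^ p * norm b ^ q)
        has_sum (norm a ^ p * (1 / (1 - norm b)))) UNIV" for p
      using has_sum_cmult_right[OF has_sum_geometric[of "norm b"]] b by simp
    show "(\<lambda>p. norm a ^ p * (1 / (1 - norm b))) summable_on UNIV"
      using has_sum_cmult_left[OF has_sum_geometric[of "norm a"], of "1 / (1 - norm b)"] a
      unfolding summable_on_def by auto
  qed auto
  then have summable: "(\<lambda>(p, q). a ^ p * b ^ q) summable_on UNIV \<times> UNIV"
    by (intro abs_summable_summable[of "\<lambda>(p, q). a ^ p * b ^ q"])
       (simp add: case_prod_unfold norm_mult norm_power)
  have "((\<lambda>(p, q). a ^ p * b ^ q) has_sum (1 / (1 - a) * (1 / (1 - b)))) (UNIV \<times> UNIV)"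
  proof (rule has_sum_SigmaI[OF _ _ summable])
    show "((\<lambda>q. case (p, q) of (p, q) \<Rightarrow> a ^ p * b ^ q) has_sum (a ^ p * (1 / (1 - b)))) UNIV" for p
      using has_sum_cmult_right[OF has_sum_geometric[OF b]] by simp
    show "((\<lambda>p. a ^ p * (1 / (1 - b))) has_sum (1 / (1 - a) * (1 / (1 - b)))) UNIV"
      by (rule has_sum_cmult_left[OF has_sum_geometric[OF a]])
  qed
  then show ?thesis by simp
qed

lemma linear_factors_cubic:
  fixes a b c :: "'a :: comm_ring_1"
  shows "[:1, - a:] * [:1, - b:] * [:1, - c:]
           = [:1, - (a + b + c), a * b + a * c + b * c, - (a * b * c):]"
  by (simp add: algebra_simps)

text \<open>Logarithmic derivatives add over factors, and each factor contributes
  \<open>- a * x / (1 - a * x) = 1 - 1 / (1 - a * x)\<close>; the three ones make up the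
  \<open>3\<close>.\<close>

lemma log_deriv_cubic:
  fixes a b c x :: complex
  assumes "a * x \<noteq> 1" "b * x \<noteq> 1" "c * x \<noteq> 1"
    and p: "p = [:1, - a:] * [:1, - b:] * [:1, - c:]"
  shows "x * (poly (pderiv p) x / poly p x)
           = 3 - (1 / (1 - a * x) + 1 / (1 - b * x) + 1 / (1 - c * x))"
proof -
  define u v w where "u = 1 - a * x" and "v = 1 - b * x" and "w = 1 - c * x"
  have nz: "u \<noteq> 0" "v \<noteq> 0" "w \<noteq> 0"
    using assms by (auto simp: u_def v_def w_def)
  have "poly p x = u * v * w"
    by (simp add: p u_def v_def w_def algebra_simps)
  \<comment> \<open>Product rule, where \<open>x\<close> times the derivative of
    \<open>1 - a * x\<close> is \<open>- a * x = u - 1\<close>, and likewise for \<open>v\<close>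
    and \<open>w\<close>.\<close>
  moreover have "x * poly (pderiv p) x = (u - 1) * v * w + u * (v - 1) * w + u * v * (w - 1)"
    by (simp add: p u_def v_def w_def pderiv_mult pderiv_pCons algebra_simps)
  ultimately have "x * (poly (pderiv p) x / poly p x) = 3 - (1 / u + 1 / v + 1 / w)"
    using nz by (simp add: divide_simps) (simp add: algebra_simps)
  then show ?thesis by (simp add: u_def v_def w_def)
qed

text \<open>With \<open>s = z * X\<close> and \<open>t = inverse z * Y\<close> the factor
  \<open>z\<close> cancels in \<open>s * t = X * Y\<close>, and
  \<open>(1 - s) + (1 - t) - (1 - s) * (1 - t) = 1 - s * t\<close>.\<close>

lemma geometric_product_partial_fraction:
  fixes z X Y :: complex
  assumes "z \<noteq> 0" "z * X \<noteq> 1" "inverse z * Y \<noteq> 1" "X * Y \<noteq> 1"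
  shows "1 / (1 - z * X) * (1 / (1 - inverse z * Y))
           = 1 / (1 - X * Y) * (1 / (1 - z * X) + 1 / (1 - inverse z * Y) - 1)"
proof -
  define s t where "s = z * X" and "t = inverse z * Y"
  have "X * Y = s * t" using assms(1) by (simp add: s_def t_def field_simps)
  moreover have "1 - s \<noteq> 0" "1 - t \<noteq> 0" "1 - s * t \<noteq> 0"
    using assms calculation by (auto simp: s_def t_def)
  ultimately have "1 / (1 - s) * (1 / (1 - t)) = 1 / (1 - X * Y) * (1 / (1 - s) + 1 / (1 - t) - 1)"
    by (simp add: divide_simps) (simp add: algebra_simps)
  then show ?thesis by (simp add: s_def t_def)
qed

text \<open>The diagonal products in \<open>T_p T_{-q}\<close> add up to \<open>T_{p-q}\<close>, so
  only pairs of distinct indices survive, each separated into a power in \<open>p\<close> times a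
  power in \<open>q\<close>.\<close>

lemma S_coeff_eq:
  assumes "z1 \<noteq> 0" "z2 \<noteq> 0" "z3 \<noteq> 0"
  shows "S_coeff z1 z2 z3 p q =
           z1 ^ p * inverse z2 ^ q + z1 ^ p * inverse z3 ^ q + z2 ^ p * inverse z1 ^ q
           + z2 ^ p * inverse z3 ^ q + z3 ^ p * inverse z1 ^ q + z3 ^ p * inverse z2 ^ q"
proof -
  have "z powi (int p - int q) = z ^ p * inverse z ^ q" if "z \<noteq> 0" for z :: complex
    using that by (simp add: power_int_diff power_inverse divide_inverse)
  then show ?thesis
    using assms
    by (simp add: S_coeff_def power_sum_def power_int_minus power_inverse algebra_simps)
qed

theorem proposition8p6:
  fixes z1 z2 z3 Z Zb X Y :: complex
  assumes "norm z1 = 1" and "norm z2 = 1" and "norm z3 = 1"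
    and "z1 * z2 * z3 = 1"
    and "Z = 1 / 3 * power_sum z1 z2 z3 1"
    and "Zb = 1 / 3 * power_sum z1 z2 z3 (- 1)"
    and "norm X < 1" and "norm Y < 1"
  shows "((\<lambda>(p, q). S_coeff z1 z2 z3 p q * X ^ p * Y ^ q) has_sum
           ((3 - X * (poly (pderiv (Pbar_poly Z Zb)) X / poly (Pbar_poly Z Zb) X))
              * (3 - Y * (poly (pderiv (P_poly Z Zb)) Y / poly (P_poly Z Zb) Y))
            + 1 / (1 - X * Y)
              * (X * (poly (pderiv (Pbar_poly Z Zb)) X / poly (Pbar_poly Z Zb) X)
                 + Y * (poly (pderiv (P_poly Z Zb)) Y / poly (P_poly Z Zb) Y) - 3)))
         (UNIV :: (nat \<times> nat) set)"
proof -
  have nz: "z1 \<noteq> 0" "z2 \<noteq> 0" "z3 \<noteq> 0"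
    using assms(1-3) by auto
  have lt: "norm (z * X) < 1" "norm (inverse z * Y) < 1" if "norm z = 1" for z
    using that assms(7,8) by (simp_all add: norm_mult norm_inverse)
  then have ne: "z * X \<noteq> 1" "inverse z * Y \<noteq> 1" if "norm z = 1" for z
    using that by (metis norm_one less_irrefl)+
  have "norm (X * Y) < 1"
    using norm_mult_less[OF assms(7,8)] by simp
  then have XY: "X * Y \<noteq> 1"
    by (metis norm_one less_irrefl)
  have inv: "inverse z1 = z2 * z3" "inverse z2 = z1 * z3" "inverse z3 = z1 * z2"
    using assms(4) by (auto intro!: inverse_unique simp: algebra_simps)
  \<comment> \<open>Thus \<open>3 * Z\<close> and \<open>3 * Zb\<close> are the first two elementary
    symmetric functions of the \<open>z_i\<close>.\<close>
  have Z: "3 * Z = z1 + z2 + z3" and Zb: "3 * Zb = z2 * z3 + z1 * z3 + z1 * z2"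
    unfolding assms(5,6) inv[symmetric] by (simp_all add: power_sum_def power_int_minus)
  define A B where "A = (\<lambda>z. 1 / (1 - z * X))" and "B = (\<lambda>z. 1 / (1 - inverse z * Y))"
  have "Pbar_poly Z Zb = [:1, - z1:] * [:1, - z2:] * [:1, - z3:]"
    unfolding linear_factors_cubic assms(4) by (simp add: Pbar_poly_def Z Zb)
  then have PX: "X * (poly (pderiv (Pbar_poly Z Zb)) X / poly (Pbar_poly Z Zb) X)
      = 3 - (A z1 + A z2 + A z3)"
    unfolding A_def by (intro log_deriv_cubic ne assms(1-3))
  \<comment> \<open>Passing to inverses exchanges these two symmetric functions, which is why
    \<open>P_poly\<close> is \<open>Pbar_poly\<close> with \<open>Z\<close> and \<open>Zb\<close>
    swapped.\<close>
  have pair_inv: "inverse z1 * inverse z2 = z3" "inverse z1 * inverse z3 = z2"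
      "inverse z2 * inverse z3 = z1"
    by (metis inv inverse_inverse_eq inverse_mult_distrib)+
  have "P_poly Z Zb = [:1, - inverse z1:] * [:1, - inverse z2:] * [:1, - inverse z3:]"
    using assms(4) unfolding linear_factors_cubic pair_inv
    by (simp add: P_poly_def Z Zb inv mult.commute[of z3])
  then have PY: "Y * (poly (pderiv (P_poly Z Zb)) Y / poly (P_poly Z Zb) Y)
      = 3 - (B z1 + B z2 + B z3)"
    unfolding B_def by (intro log_deriv_cubic ne assms(1-3))
  define c where "c = 1 / (1 - X * Y)"
  have AB: "A z * B z = c * (A z + B z - 1)" if "norm z = 1" for z
    unfolding A_def B_def c_def using that ne XY by (intro geometric_product_partial_fraction) auto
  define G where "G = (\<lambda>z w (p, q). (z * X) ^ p * (inverse w * Y) ^ q)"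
  have series: "(G z w has_sum (A z * B w)) UNIV" if "norm z = 1" "norm w = 1" for z w
    unfolding G_def A_def B_def using that by (intro has_sum_geometric_product lt)
  have expand: "(\<lambda>(p, q). S_coeff z1 z2 z3 p q * X ^ p * Y ^ q)
      = (\<lambda>x. G z1 z2 x + G z1 z3 x + G z2 z1 x + G z2 z3 x + G z3 z1 x + G z3 z2 x)"
    unfolding G_def S_coeff_eq[OF nz] power_mult_distrib
    by (simp add: fun_eq_iff algebra_simps del: power_inverse)
  have "A z1 * B z2 + A z1 * B z3 + A z2 * B z1 + A z2 * B z3 + A z3 * B z1 + A z3 * B z2
      = (A z1 + A z2 + A z3) * (B z1 + B z2 + B z3)
        - (A z1 * B z1 + A z2 * B z2 + A z3 * B z3)"
    by (simp add: algebra_simps)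
  \<comment> \<open>The diagonal sum is \<open>c\<close> times
    \<open>\<Sum>A_i + \<Sum>B_i - 3\<close>; its negative is written through
    \<open>3 - \<Sum>A_i\<close> and \<open>3 - \<Sum>B_i\<close>, the two logarithmic derivative
    terms.\<close>
  also have "\<dots> = (A z1 + A z2 + A z3) * (B z1 + B z2 + B z3)
      + c * ((3 - (A z1 + A z2 + A z3)) + (3 - (B z1 + B z2 + B z3)) - 3)"
    unfolding AB[OF assms(1)] AB[OF assms(2)] AB[OF assms(3)]
    by (simp add: algebra_simps)
  \<comment> \<open>The double subtractions from \<open>3\<close> reproduce the shape the goal takes
    after rewriting with \<open>PX\<close> and \<open>PY\<close>.\<close>
  finally have total: "A z1 * B z2 + A z1 * B z3 + A z2 * B z1 + A z2 * B z3
      + A z3 * B z1 + A z3 * B z2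
      = (3 - (3 - (A z1 + A z2 + A z3))) * (3 - (3 - (B z1 + B z2 + B z3)))
      + c * ((3 - (A z1 + A z2 + A z3)) + (3 - (B z1 + B z2 + B z3)) - 3)"
    by (simp only: diff_diff_eq2 add_diff_cancel_left')
  show ?thesis
    unfolding expand PX PY c_def[symmetric] total[symmetric]
    by (intro has_sum_add series assms(1-3))
qed

end
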